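(* Let $m\ge 2$ and $n\ge 5$ be integers. Then $\chi'_g(W_n;m,1)=n$.
   Context: For $n\ge 3$, the wheel $W_n$ is the graph with $n+1$ vertices obtained from the cycle $C_n$ by adding a new vertex $v_0$ adjacent to every vertex of the cycle. The $(m,1)$-edge coloring game on a finite simple graph $G$ with a set of colors $X$ is played alternately by two players, Maker and Breaker, with Maker playing first. On each turn Maker makes $m$ moves and Breaker makes one move; a move consists of coloring one uncolored edge of $G$ with a color from $X$ so that adjacent edges (edges sharing an endpoint) always receive distinct colors. Maker wins if eventually every edge is colored; Breaker wins if at some point the player who is to move cannot color any edge. The $(m,1)$-game chromatic index $\chi'_g(G;m,1)$ is the smallest nonnegative integer $k$ such that Maker has a winning strategy when $|X|=k$. *)

theory Defs
  imports Main
begin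

record 'v graph =
  verts :: "'v set"
  edges :: "'v set set"

definition simple_graph :: "'v graph \<Rightarrow> bool" where
  "simple_graph G \<longleftrightarrow>
     finite (verts G) \<and> (\<forall>e \<in> edges G. e \<subseteq> verts G \<and> card e = 2)"

(* Vertices 1, ..., n in cyclic order: the successor of i is i + 1 for i < n, and 1 for i = n. *)
definition cycle_graph :: "nat \<Rightarrow> nat graph" where
  "cycle_graph n = \<lparr> verts = {1..n}, edges = {{i, Suc (i mod n)} | i. i \<in> {1..n}} \<rparr>"

(* The new vertex v_0 is 0. *)
definition wheel :: "nat \<Rightarrow> nat graph" where
  "wheel n = \<lparr> verts = insert 0 (verts (cycle_graph n)),
               edges = edges (cycle_graph n) \<union> {{0, v} | v. v \<in> verts (cycle_graph n)} \<rparr>"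

lemma simple_graph_wheel:
  assumes "n \<ge> 3"
  shows "simple_graph (wheel n)"
proof -
  have "card {i, Suc (i mod n)} = 2 \<and> {i, Suc (i mod n)} \<subseteq> {1..n}" if "i \<in> {1..n}" for i
    using that assms by (cases "i = n") (auto simp: card_insert_if)
  moreover have "card {0, v} = 2" if "v \<in> {1..n}" for v
    using that by (auto simp: card_insert_if)
  ultimately show ?thesis
    unfolding simple_graph_def wheel_def cycle_graph_def by fastforce
qed

type_synonym ('v, 'c) move = "'v set \<times> 'c"

(* A history lists the moves made so far, oldest first.  As no edge is coloured twice,
   map_of h is the partial colouring reached by the history h. *)
type_synonym ('v, 'c) history = "('v, 'c) move list"

definition legal_move :: "'v graph \<Rightarrow> 'c set \<Rightarrow> ('v, 'c) history \<Rightarrow> ('v, 'c) move \<Rightarrow> bool" where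
  "legal_move G X h = (\<lambda>(e, x).
     e \<in> edges G \<and> map_of h e = None \<and> x \<in> X \<and>
     (\<forall>f \<in> edges G. f \<noteq> e \<and> f \<inter> e \<noteq> {} \<longrightarrow> map_of h f \<noteq> Some x))"

definition all_colored :: "'v graph \<Rightarrow> ('v, 'c) history \<Rightarrow> bool" where
  "all_colored G h \<longleftrightarrow> (\<forall>e \<in> edges G. map_of h e \<noteq> None)"

(* A round consists of m moves of Maker followed by one move of Breaker. *)
definition maker_to_move :: "nat \<Rightarrow> ('v, 'c) history \<Rightarrow> bool" where
  "maker_to_move m h \<longleftrightarrow> length h mod (m + 1) < m"

type_synonym ('v, 'c) strategy = "('v, 'c) history \<Rightarrow> ('v, 'c) move"

inductive_set plays ::
  "'v graph \<Rightarrow> 'c set \<Rightarrow> nat \<Rightarrow> ('v, 'c) strategy \<Rightarrow> ('v, 'c) history set"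
  for G :: "'v graph" and X :: "'c set" and m :: nat and \<sigma> :: "('v, 'c) strategy" where
  start: "[] \<in> plays G X m \<sigma>"
| maker: "h \<in> plays G X m \<sigma> \<Longrightarrow> maker_to_move m h \<Longrightarrow> legal_move G X h (\<sigma> h)
    \<Longrightarrow> h @ [\<sigma> h] \<in> plays G X m \<sigma>"
| breaker: "h \<in> plays G X m \<sigma> \<Longrightarrow> \<not> maker_to_move m h \<Longrightarrow> legal_move G X h a
    \<Longrightarrow> h @ [a] \<in> plays G X m \<sigma>"

(* The first conjunct says that the strategy prescribes a legal move whenever Maker has one.
   The second says that Breaker never wins, i.e. that no play reaches a position in which some
   edge is uncoloured but the player to move cannot colour any edge.  On a finite graph every
   play ends, so Maker then wins every play. *)
definition winning_strategy ::
  "'v graph \<Rightarrow> 'c set \<Rightarrow> nat \<Rightarrow> ('v, 'c) strategy \<Rightarrow> bool" where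
  "winning_strategy G X m \<sigma> \<longleftrightarrow>
     (\<forall>h \<in> plays G X m \<sigma>.
        (maker_to_move m h \<and> (\<exists>a. legal_move G X h a) \<longrightarrow> legal_move G X h (\<sigma> h)) \<and>
        ((\<nexists>a. legal_move G X h a) \<longrightarrow> all_colored G h))"

(* The colour set is {0, ..., k - 1}: the outcome only depends on the number of colours. *)
definition game_chromatic_index :: "'v graph \<Rightarrow> nat \<Rightarrow> nat" where
  "game_chromatic_index G m =
     (LEAST k. \<exists>\<sigma> :: ('v, nat) strategy. winning_strategy G {..<k} m \<sigma>)"

end

(* The n spokes meet at the hub, so n colours are necessary, and with n colours the spokes use all of
   them.  Since n >= 5, rim edges can always be coloured; Breaker can only hope to ruin a spoke by
   putting a colour not yet used on the spokes on a rim edge next to it.  Maker colours spokes and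
   keeps every rim edge at an uncoloured spoke free of such colours at the end of his turn.  If
   Breaker then puts a new colour a on a rim edge, this affects at most two spokes; Maker answers by
   using a on a third one, after which a is harmless.  The endgame is critical: Maker must not hand
   over a position with exactly one uncoloured spoke, or with two uncoloured spokes joined by an
   uncoloured rim edge.  He avoids this by leaving a nonadjacent pair or, if only the parity is
   wrong, by spending one move on the rim. *)

theory Submission imports Defs
begin

section \<open>Positions as partial colourings\<close>

text \<open>Legality expressed on the partial colouring alone, so that invariants need not mention
  histories.\<close>

definition colorable :: "'v graph \<Rightarrow> 'c set \<Rightarrow> ('v set \<Rightarrow> 'c option) \<Rightarrow> 'v set \<Rightarrow> 'c \<Rightarrow> bool" where
  "colorable G X f e x \<longleftrightarrow>
     e \<in> edges G \<and> f e = None \<and> x \<in> X \<and> (\<forall>d \<in> edges G. d \<noteq> e \<and> d \<inter> e \<noteq> {} \<longrightarrow> f d \<noteq> Some x)"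

definition proper_coloring :: "'v graph \<Rightarrow> 'c set \<Rightarrow> ('v set \<Rightarrow> 'c option) \<Rightarrow> bool" where
  "proper_coloring G X f \<longleftrightarrow>
     (\<forall>e \<in> edges G. \<forall>x. f e = Some x \<longrightarrow>
        x \<in> X \<and> (\<forall>d \<in> edges G. d \<noteq> e \<and> d \<inter> e \<noteq> {} \<longrightarrow> f d \<noteq> Some x))"

lemma proper_coloringD:
  assumes "proper_coloring G X f" "e \<in> edges G" "f e = Some x"
  shows "x \<in> X" and "d \<in> edges G \<Longrightarrow> d \<noteq> e \<Longrightarrow> d \<inter> e \<noteq> {} \<Longrightarrow> f d \<noteq> Some x"
  using assms unfolding proper_coloring_def by blast+

lemma legal_move_iff_colorable:
  "legal_move G X h a \<longleftrightarrow> colorable G X (map_of h) (fst a) (snd a)"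
  by (cases a) (auto simp: legal_move_def colorable_def)

text \<open>\<open>map_of\<close> returns the first match, so appending a move acts as an update
  only because its edge is new.\<close>

lemma map_of_snoc:
  assumes "map_of h (fst a) = None"
  shows "map_of (h @ [a]) = (map_of h)(fst a \<mapsto> snd a)"
  using assms by (cases a) (auto simp: map_add_def fun_eq_iff split: option.splits)

lemma map_of_legal_move:
  assumes "legal_move G X h a"
  shows "map_of (h @ [a]) = (map_of h)(fst a \<mapsto> snd a)"
  by (rule map_of_snoc) (use assms in \<open>auto simp: legal_move_iff_colorable colorable_def\<close>)

text \<open>Legality tests only the new edge against its neighbours; since adjacency is symmetric,
  this also protects the edges coloured earlier.\<close>

lemma proper_coloring_update:
  assumes "proper_coloring G X f" and "colorable G X f e x"
  shows "proper_coloring G X (f(e \<mapsto> x))"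
  unfolding proper_coloring_def
proof (intro ballI allI impI conjI)
  fix d y assume d: "d \<in> edges G" and y: "(f(e \<mapsto> x)) d = Some y"
  show "y \<in> X"
  proof (cases "d = e")
    case True
    then show ?thesis using assms(2) y unfolding colorable_def by simp
  next
    case False
    then have "f d = Some y" using y by simp
    then show ?thesis using proper_coloringD(1)[OF assms(1) d] by simp
  qed
  fix c assume c: "c \<in> edges G" "c \<noteq> d \<and> c \<inter> d \<noteq> {}"
  have new: "f b \<noteq> Some x" if "b \<in> edges G" "b \<noteq> e" "b \<inter> e \<noteq> {}" for b
    using assms(2) that unfolding colorable_def by blast
  consider "d = e" | "d \<noteq> e" "c = e" | "d \<noteq> e" "c \<noteq> e" by blast
  then show "(f(e \<mapsto> x)) c \<noteq> Some y"
  proof cases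
    case 1
    then show ?thesis using new[of c] c y by simp
  next
    case 2
    then have "f d \<noteq> Some x" using new[of d] c d by (simp add: Int_commute)
    then show ?thesis using 2 y by auto
  next
    case 3
    then have "f d = Some y" using y by simp
    then have "f c \<noteq> Some y" using proper_coloringD(2)[OF assms(1) d] c by blast
    then show ?thesis using 3 by simp
  qed
qed

text \<open>The parameter \<open>k\<close> of an invariant counts the moves left to Maker in the current
  turn, so that \<open>k = 0\<close> means that Breaker is to move.\<close>

lemma winning_strategy_if_invariant:
  fixes P :: "nat \<Rightarrow> ('v set \<Rightarrow> 'c option) \<Rightarrow> bool"
  assumes start: "P m Map.empty"
    and breaker: "\<And>f e x. P 0 f \<Longrightarrow> colorable G X f e x \<Longrightarrow> P m (f(e \<mapsto> x))"
    and maker: "\<And>k f. P (Suc k) f \<Longrightarrow> \<exists>e x. colorable G X f e x \<Longrightarrow>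
                  \<exists>e x. colorable G X f e x \<and> P k (f(e \<mapsto> x))"
    and stuck: "\<And>k f e. P k f \<Longrightarrow> e \<in> edges G \<Longrightarrow> f e = None \<Longrightarrow> \<exists>e x. colorable G X f e x"
  shows "\<exists>\<sigma>. winning_strategy G X m \<sigma>"
proof -
  \<comment> \<open>The moves Maker still has in the current turn; zero exactly when Breaker is to
    move, whose move resets it to \<open>m\<close>.\<close>
  define r :: "('v, 'c) history \<Rightarrow> nat" where "r h = m - length h mod (m + 1)" for h
  \<comment> \<open>Any legal move that preserves the invariant will do; the hypothesis
    \<open>maker\<close> provides one whenever Maker can move at all.\<close>
  define \<sigma> :: "('v, 'c) strategy" where
    "\<sigma> h = (SOME a. legal_move G X h a \<and> P (r h - 1) (map_of (h @ [a])))" for h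
  have r0: "r h = 0 \<longleftrightarrow> \<not> maker_to_move m h" for h
    by (auto simp: r_def maker_to_move_def)
  have r_snoc: "r (h @ [a]) = (if r h = 0 then m else r h - 1)" for h a
    using mod_less_divisor[of "Suc m" "length h"]
    by (auto simp: r_def mod_Suc simp del: mod_less_divisor)
  have \<sigma>: "legal_move G X h (\<sigma> h) \<and> P (r h - 1) (map_of (h @ [\<sigma> h]))"
    if P: "P (r h) (map_of h)" and mv: "maker_to_move m h" and ex: "\<exists>a. legal_move G X h a" for h
  proof -
    obtain k where k: "r h = Suc k" using mv r0[of h] by (cases "r h") auto
    have "\<exists>e x. colorable G X (map_of h) e x"
      using ex by (auto simp: legal_move_iff_colorable)
    then obtain e x where ex: "colorable G X (map_of h) e x" "P k ((map_of h)(e \<mapsto> x))"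
      using maker P k by metis
    then have l: "legal_move G X h (e, x)" by (simp add: legal_move_iff_colorable)
    have "\<exists>a. legal_move G X h a \<and> P (r h - 1) (map_of (h @ [a]))"
      by (rule exI[of _ "(e, x)"]) (use l ex k map_of_legal_move[OF l] in simp)
    then show ?thesis unfolding \<sigma>_def by (rule someI_ex)
  qed
  have P: "P (r h) (map_of h)" if "h \<in> plays G X m \<sigma>" for h
    using that
  proof induction
    case start
    then show ?case using assms(1) by (simp add: r_def)
  next
    case (maker h)
    have "r h \<noteq> 0" using maker r0 by blast
    then show ?case using \<sigma>[of h] maker by (auto simp only: r_snoc if_False)
  next
    case (breaker h a)
    have "r h = 0" using breaker r0 by blast
    then have "P 0 (map_of h)" using breaker.IH by simp
    then have "P m ((map_of h)(fst a \<mapsto> snd a))"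
      using assms(2) breaker(3) by (auto simp: legal_move_iff_colorable)
    then show ?case using \<open>r h = 0\<close> by (simp add: r_snoc map_of_legal_move[OF breaker(3)] del: map_of_append fun_upd_apply)
  qed
  have "winning_strategy G X m \<sigma>"
    unfolding winning_strategy_def
  proof (intro ballI conjI impI)
    fix h assume h: "h \<in> plays G X m \<sigma>"
    show "legal_move G X h (\<sigma> h)"
      if "maker_to_move m h \<and> (\<exists>a. legal_move G X h a)"
      using \<sigma> P[OF h] that by blast
    show "all_colored G h" if "\<nexists>a. legal_move G X h a"
    proof (rule ccontr)
      assume "\<not> all_colored G h"
      then obtain e where "e \<in> edges G" "map_of h e = None" by (auto simp: all_colored_def)
      then obtain e x where "colorable G X (map_of h) e x" using stuck[OF P[OF h]] by blast
      then have "legal_move G X h (e, x)" by (simp add: legal_move_iff_colorable)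
      then show False using that by blast
    qed
  qed
  then show ?thesis by blast
qed

section \<open>Complete colourings from winning strategies\<close>

text \<open>Distinctness of the coloured edges is what bounds the length of a play.\<close>

lemma plays_proper:
  assumes "h \<in> plays G X m \<sigma>"
  shows "distinct (map fst h) \<and> fst ` set h \<subseteq> edges G \<and> proper_coloring G X (map_of h)"
proof -
  have extend: "distinct (map fst (h @ [a])) \<and> fst ` set (h @ [a]) \<subseteq> edges G
      \<and> proper_coloring G X (map_of (h @ [a]))"
    if "distinct (map fst h) \<and> fst ` set h \<subseteq> edges G \<and> proper_coloring G X (map_of h)"
      and a: "legal_move G X h a" for h a
  proof -
    have col: "colorable G X (map_of h) (fst a) (snd a)"
      using a by (simp add: legal_move_iff_colorable)
    then have "fst a \<in> edges G" "fst a \<notin> fst ` set h"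
      by (simp_all add: colorable_def map_of_eq_None_iff)
    moreover have "proper_coloring G X (map_of (h @ [a]))"
      unfolding map_of_legal_move[OF a]
      by (rule proper_coloring_update[OF _ col]) (use that(1) in \<open>elim conjE\<close>)
    ultimately show ?thesis using that(1) by (simp del: map_of_append)
  qed
  show ?thesis
    using assms
  proof induction
    case start
    show ?case by (simp add: proper_coloring_def)
  next
    case (maker h)
    then show ?case by (intro extend)
  next
    case (breaker h a)
    then show ?case by (intro extend)
  qed
qed

text \<open>A longest play consistent with the strategy admits no further move, so by the winning
  condition it has coloured every edge, and plays are proper.\<close>

lemma winning_strategy_imp_proper_coloring:
  assumes fin: "finite (edges G)" and win: "winning_strategy G X m \<sigma>"
  shows "\<exists>f. proper_coloring G X f \<and> (\<forall>e \<in> edges G. f e \<noteq> None)"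
proof -
  have len: "length h \<le> card (edges G)" if "h \<in> plays G X m \<sigma>" for h
  proof -
    have "length h = card (fst ` set h)"
      using plays_proper[OF that] distinct_card[of "map fst h"] by simp
    also have "\<dots> \<le> card (edges G)"
      using plays_proper[OF that] by (intro card_mono fin) blast
    finally show ?thesis .
  qed
  \<comment> \<open>The bound in \<open>ex_has_greatest_nat\<close> is strict, hence the
    \<open>Suc\<close>.\<close>
  have "\<exists>h. h \<in> plays G X m \<sigma> \<and> (\<forall>h'. h' \<in> plays G X m \<sigma> \<longrightarrow> length h' \<le> length h)"
    using plays.start len
    by (intro ex_has_greatest_nat[where P = "\<lambda>h. h \<in> plays G X m \<sigma>" and k = "[]"
          and f = length and b = "Suc (card (edges G))"]) (simp_all add: less_Suc_eq_le)
  then obtain h where h: "h \<in> plays G X m \<sigma>"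
    and max: "\<And>h'. h' \<in> plays G X m \<sigma> \<Longrightarrow> length h' \<le> length h"
    by blast
  have "\<nexists>a. legal_move G X h a"
  proof
    assume ex: "\<exists>a. legal_move G X h a"
    \<comment> \<open>A remaining legal move would extend the play: on Maker's turn because the
      strategy then prescribes a legal move, on Breaker's turn by that very move.\<close>
    obtain a where "h @ [a] \<in> plays G X m \<sigma>"
    proof (cases "maker_to_move m h")
      case True
      then have "legal_move G X h (\<sigma> h)" using win h ex by (simp add: winning_strategy_def)
      then show ?thesis using that plays.maker[OF h True] by blast
    next
      case False
      then show ?thesis using that plays.breaker[OF h False] ex by blast
    qed
    then show False using max by fastforce
  qed
  then have "all_colored G h" using win h unfolding winning_strategy_def by blast
  then show ?thesis using plays_proper[OF h] unfolding all_colored_def by blast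
qed

section \<open>Spokes and rim edges\<close>

lemma edges_wheel: "edges (wheel n) = edges (cycle_graph n) \<union> (\<lambda>v. {0, v}) ` {1..n}"
  by (auto simp: wheel_def cycle_graph_def)

lemma wheel_edge_cases:
  assumes "e \<in> edges (wheel n)"
  obtains (rim) "e \<in> edges (cycle_graph n)" | (spoke) v where "v \<in> {1..n}" "e = {0, v}"
  using assms unfolding edges_wheel by blast

lemma finite_edges_cycle_graph: "finite (edges (cycle_graph n))"
proof -
  have "edges (cycle_graph n) = (\<lambda>i. {i, Suc (i mod n)}) ` {1..n}"
    by (auto simp: cycle_graph_def)
  then show ?thesis by simp
qed

lemma rim_edge_subset: "e \<in> edges (cycle_graph n) \<Longrightarrow> e \<subseteq> {1..n}"
  by (auto simp: cycle_graph_def Suc_le_eq)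

lemma card_rim_edge_le: "e \<in> edges (cycle_graph n) \<Longrightarrow> card e \<le> 2"
  by (auto simp: cycle_graph_def card_insert_if)

lemma zero_notin_rim_edge: "e \<in> edges (cycle_graph n) \<Longrightarrow> 0 \<notin> e"
  using rim_edge_subset by force

lemma rim_edge_neq_spoke: "e \<in> edges (cycle_graph n) \<Longrightarrow> e \<noteq> {0, v}"
  using zero_notin_rim_edge by blast

lemma card_edges_cycle_graph:
  assumes "n \<ge> 3"
  shows "card (edges (cycle_graph n)) = n"
proof -
  have "edges (cycle_graph n) = (\<lambda>i. {i, Suc (i mod n)}) ` {1..n}"
    by (auto simp: cycle_graph_def)
  moreover have "inj_on (\<lambda>i. {i, Suc (i mod n)}) {1..n}"
  proof (rule inj_onI)
    fix i j assume "i \<in> {1..n}" "j \<in> {1..n}" "{i, Suc (i mod n)} = {j, Suc (j mod n)}"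
    then show "i = j"
      using assms by (cases "i = n"; cases "j = n") (auto simp: doubleton_eq_iff)
  qed
  ultimately show ?thesis by (simp add: card_image)
qed

lemma rim_pair_less:
  assumes "e \<in> edges (cycle_graph n)" and "p \<in> e" "q \<in> e" "p < q"
  shows "q = Suc p \<or> p = 1 \<and> q = n"
proof -
  obtain i where "i \<in> {1..n}" "e = {i, Suc (i mod n)}"
    using assms(1) by (auto simp: cycle_graph_def)
  then show ?thesis using assms by (cases "i = n") auto
qed

text \<open>A cycle of length at least 4 has no triangle, so two of three rim vertices are not
  joined; \<open>v\<close> is the third. This lets Maker leave a nonadjacent pair.\<close>

lemma nonadjacent_pair:
  assumes n: "n \<ge> 4" and U: "U \<subseteq> {1..n}" "card U = 3"
  shows "\<exists>v \<in> U. \<forall>e \<in> edges (cycle_graph n). \<not> U - {v} \<subseteq> e"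
proof (rule ccontr)
  assume "\<not> ?thesis"
  then have ex: "\<And>v. v \<in> U \<Longrightarrow> \<exists>e \<in> edges (cycle_graph n). U - {v} \<subseteq> e" by blast
  have fin: "finite U" using U finite_subset by blast
  define a where "a = Min U"
  define c where "c = Max U"
  have ne: "U \<noteq> {}" using U by auto
  have a: "a \<in> U" "\<And>x. x \<in> U \<Longrightarrow> a \<le> x" using fin ne by (auto simp: a_def)
  have c: "c \<in> U" "\<And>x. x \<in> U \<Longrightarrow> x \<le> c" using fin ne by (auto simp: c_def)
  have "\<not> U \<subseteq> {a, c}"
  proof
    assume "U \<subseteq> {a, c}"
    then have "card U \<le> card {a, c}" by (intro card_mono) auto
    then show False using U by (auto simp: card_insert_if split: if_splits)
  qed
  then obtain b where b: "b \<in> U" "b \<noteq> a" "b \<noteq> c" by blast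
  then have ord: "a < b" "b < c" using a c by force+
  have edge: "q = Suc p \<or> p = 1 \<and> q = n" if "p \<in> U" "q \<in> U" "r \<in> U" "r \<noteq> p" "r \<noteq> q" "p < q" for p q r
    using ex[OF that(3)] rim_pair_less[of _ n p q] that by blast
  \<comment> \<open>If all three pairs were joined, \<open>a < b < c\<close> would be consecutive
    while \<open>a\<close> and \<open>c\<close> are joined around the end, forcing
    \<open>n = 3\<close>.\<close>
  have "b = Suc a \<or> a = 1 \<and> b = n" using edge[of a b c] a c b ord by auto
  moreover have "c = Suc b \<or> b = 1 \<and> c = n" using edge[of b c a] a c b ord by auto
  moreover have "c = Suc a \<or> a = 1 \<and> c = n" using edge[of a c b] a c b ord by auto
  moreover have "1 \<le> a" "c \<le> n" using U a c by auto
  ultimately show False using ord n by auto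
qed

text \<open>Only the predecessor and the successor of a rim edge on the cycle meet it.\<close>

lemma adjacent_rim_edges:
  assumes n: "n \<ge> 3" and e: "e \<in> edges (cycle_graph n)"
  shows "card {d \<in> edges (cycle_graph n). d \<noteq> e \<and> d \<inter> e \<noteq> {}} \<le> 2"
proof -
  obtain i where i: "i \<in> {1..n}" "e = {i, Suc (i mod n)}"
    using e by (auto simp: cycle_graph_def)
  define r where "r j = {j, Suc (j mod n)}" for j
  define p where "p = (if i = 1 then n else i - 1)"
  have mod_n: "k mod n = (if k = n then 0 else k)" if "k \<in> {1..n}" for k
    using that by auto
  have "d \<in> {r p, r (Suc (i mod n))}"
    if d: "d \<in> edges (cycle_graph n)" "d \<noteq> e" "d \<inter> e \<noteq> {}" for d
  proof -
    obtain j where j: "j \<in> {1..n}" "d = {j, Suc (j mod n)}"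
      using d by (auto simp: cycle_graph_def)
    have ji: "j \<noteq> i" using d i j by auto
    have "i = Suc (j mod n) \<or> j = Suc (i mod n) \<or> Suc (j mod n) = Suc (i mod n)"
      using d(3) i j ji by auto
    moreover have "Suc (j mod n) \<noteq> Suc (i mod n)"
      using i(1) j(1) ji by (simp add: mod_n split: if_splits)
    moreover have "j = p" if "i = Suc (j mod n)"
      using that i(1) j(1) by (simp add: mod_n p_def split: if_splits)
    ultimately show ?thesis using j by (auto simp: r_def)
  qed
  then have "{d \<in> edges (cycle_graph n). d \<noteq> e \<and> d \<inter> e \<noteq> {}} \<subseteq> {r p, r (Suc (i mod n))}"
    by blast
  then have "card {d \<in> edges (cycle_graph n). d \<noteq> e \<and> d \<inter> e \<noteq> {}} \<le> card {r p, r (Suc (i mod n))}"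
    by (intro card_mono) auto
  also have "\<dots> \<le> 2" by (auto simp: card_insert_if)
  finally show ?thesis .
qed

section \<open>Colours and counts of a position\<close>

definition open_spokes :: "nat \<Rightarrow> (nat set \<Rightarrow> 'c option) \<Rightarrow> nat set" where
  "open_spokes n f = {v \<in> {1..n}. f {0, v} = None}"

definition spoke_colors :: "nat \<Rightarrow> (nat set \<Rightarrow> 'c option) \<Rightarrow> 'c set" where
  "spoke_colors n f = {x. \<exists>v \<in> {1..n}. f {0, v} = Some x}"

definition colored_rim :: "nat \<Rightarrow> (nat set \<Rightarrow> 'c option) \<Rightarrow> nat set set" where
  "colored_rim n f = {e \<in> edges (cycle_graph n). f e \<noteq> None}"

text \<open>For \<open>S = spoke_colors n f\<close>, the rim then excludes no colour at an open
  spoke that the hub does not exclude already. Maker keeps this true; a threat enlarges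
  \<open>S\<close> by one colour.\<close>

definition rim_colors_in :: "nat \<Rightarrow> (nat set \<Rightarrow> 'c option) \<Rightarrow> 'c set \<Rightarrow> bool" where
  "rim_colors_in n f S \<longleftrightarrow>
     (\<forall>v \<in> open_spokes n f. \<forall>e \<in> edges (cycle_graph n). v \<in> e \<longrightarrow> (\<forall>x. f e = Some x \<longrightarrow> x \<in> S))"

lemma finite_open_spokes: "finite (open_spokes n f)"
  by (simp add: open_spokes_def)

lemma card_open_spokes_le: "card (open_spokes n f) \<le> n"
proof -
  have "open_spokes n f \<subseteq> {1..n}" by (auto simp: open_spokes_def)
  then show ?thesis using card_mono[of "{1..n}" "open_spokes n f"] by simp
qed

lemma finite_colored_rim: "finite (colored_rim n f)"
  using finite_edges_cycle_graph[of n] by (simp add: colored_rim_def)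

lemma spoke_update:
  assumes "v \<in> open_spokes n f"
  shows "open_spokes n (f({0, v} \<mapsto> x)) = open_spokes n f - {v}"
    and "spoke_colors n (f({0, v} \<mapsto> x)) = insert x (spoke_colors n f)"
    and "colored_rim n (f({0, v} \<mapsto> x)) = colored_rim n f"
    and "e \<in> edges (cycle_graph n) \<Longrightarrow> (f({0, v} \<mapsto> x)) e = f e"
proof -
  have eq: "{0, w} = {0, v} \<longleftrightarrow> w = v" for w by (auto simp: doubleton_eq_iff)
  have neq: "d \<noteq> {0, v}" if "d \<in> edges (cycle_graph n)" for d
    using rim_edge_neq_spoke that by blast
  have v: "v \<in> {1..n}" "f {0, v} = None" using assms by (simp_all add: open_spokes_def)
  show "open_spokes n (f({0, v} \<mapsto> x)) = open_spokes n f - {v}"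
    by (auto simp: open_spokes_def eq)
  show "spoke_colors n (f({0, v} \<mapsto> x)) = insert x (spoke_colors n f)"
  proof (intro set_eqI iffI)
    fix y assume "y \<in> insert x (spoke_colors n f)"
    then consider "y = x" | w where "w \<in> {1..n}" "w \<noteq> v" "f {0, w} = Some y"
      using v by (force simp: spoke_colors_def)
    then show "y \<in> spoke_colors n (f({0, v} \<mapsto> x))"
      using v eq by cases (force simp: spoke_colors_def)+
  qed (auto simp: spoke_colors_def eq split: if_splits)
  show "colored_rim n (f({0, v} \<mapsto> x)) = colored_rim n f"
    using neq by (auto simp: colored_rim_def)
  show "(f({0, v} \<mapsto> x)) e = f e" if "e \<in> edges (cycle_graph n)"
    using neq[OF that] by simp
qed

lemma rim_update:
  assumes "e \<in> edges (cycle_graph n)"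
  shows "open_spokes n (f(e \<mapsto> x)) = open_spokes n f"
    and "spoke_colors n (f(e \<mapsto> x)) = spoke_colors n f"
    and "colored_rim n (f(e \<mapsto> x)) = insert e (colored_rim n f)"
proof -
  have neq: "{0, v} \<noteq> e" for v using rim_edge_neq_spoke[OF assms] by blast
  show "open_spokes n (f(e \<mapsto> x)) = open_spokes n f"
    by (simp add: open_spokes_def neq)
  show "spoke_colors n (f(e \<mapsto> x)) = spoke_colors n f"
    by (simp add: spoke_colors_def neq)
  show "colored_rim n (f(e \<mapsto> x)) = insert e (colored_rim n f)"
    using assms by (auto simp: colored_rim_def)
qed

lemma card_open_spokes_update:
  "v \<in> open_spokes n f \<Longrightarrow> card (open_spokes n (f({0, v} \<mapsto> x))) = card (open_spokes n f) - 1"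
  by (simp add: spoke_update(1))

lemma card_colored_rim_update:
  assumes "e \<in> edges (cycle_graph n)" "f e = None"
  shows "card (colored_rim n (f(e \<mapsto> x))) = Suc (card (colored_rim n f))"
proof -
  have "e \<notin> colored_rim n f" using assms by (simp add: colored_rim_def)
  then show ?thesis using assms by (simp add: rim_update(3) finite_colored_rim)
qed

lemma spoke_colors_subset: "proper_coloring (wheel n) X f \<Longrightarrow> spoke_colors n f \<subseteq> X"
  by (auto simp: proper_coloring_def spoke_colors_def edges_wheel)

lemma proper_spokes_distinct:
  assumes "proper_coloring (wheel n) X f" "v \<in> {1..n}" "w \<in> {1..n}"
    and "f {0, v} = Some x" "f {0, w} = Some x"
  shows "v = w"
proof (rule ccontr)
  assume "v \<noteq> w"
  then have "{0, w} \<noteq> {0, v}" "{0, w} \<inter> {0, v} \<noteq> {}" by (auto simp: doubleton_eq_iff)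
  moreover have "{0, v} \<in> edges (wheel n)" "{0, w} \<in> edges (wheel n)"
    using assms by (auto simp: edges_wheel)
  ultimately show False
    using proper_coloringD(2)[OF assms(1) _ assms(4)] assms(5) by simp
qed

text \<open>All spokes meet at the hub, so distinct coloured spokes contribute distinct
  colours.\<close>

lemma card_spoke_colors:
  assumes "proper_coloring (wheel n) X f"
  shows "card (spoke_colors n f) = n - card (open_spokes n f)"
proof -
  have "spoke_colors n f = (\<lambda>v. the (f {0, v})) ` ({1..n} - open_spokes n f)"
    by (force simp: spoke_colors_def open_spokes_def image_iff)
  moreover have "inj_on (\<lambda>v. the (f {0, v})) ({1..n} - open_spokes n f)"
    using proper_spokes_distinct[OF assms] by (intro inj_onI) (force simp: open_spokes_def)
  moreover have "card ({1..n} - open_spokes n f) = n - card (open_spokes n f)"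
    by (subst card_Diff_subset) (auto simp: open_spokes_def)
  ultimately show ?thesis by (simp add: card_image)
qed

lemma unused_color:
  assumes "proper_coloring (wheel n) {..<n} f" and "open_spokes n f \<noteq> {}"
  shows "\<exists>x < n. x \<notin> spoke_colors n f"
proof (rule ccontr)
  assume "\<not> ?thesis"
  then have "{..<n} \<subseteq> spoke_colors n f" by auto
  moreover have "finite (spoke_colors n f)"
    using spoke_colors_subset[OF assms(1)] finite_subset by blast
  ultimately have "n \<le> card (spoke_colors n f)"
    using card_mono[of "spoke_colors n f" "{..<n}"] by simp
  moreover have "card (open_spokes n f) > 0"
    using assms finite_open_spokes card_gt_0_iff by blast
  moreover have "card (open_spokes n f) \<le> n" by (rule card_open_spokes_le)
  ultimately show False using card_spoke_colors[OF assms(1)] by simp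
qed

lemma spoke_colorable:
  assumes "v \<in> open_spokes n f" "x \<in> X" "x \<notin> spoke_colors n f"
    and "\<And>e. e \<in> edges (cycle_graph n) \<Longrightarrow> v \<in> e \<Longrightarrow> f e \<noteq> Some x"
  shows "colorable (wheel n) X f {0, v} x"
  unfolding colorable_def
proof (intro conjI ballI impI)
  show "{0, v} \<in> edges (wheel n)" "f {0, v} = None" "x \<in> X"
    using assms by (auto simp: open_spokes_def edges_wheel)
  fix d assume "d \<in> edges (wheel n)" and d: "d \<noteq> {0, v} \<and> d \<inter> {0, v} \<noteq> {}"
  from this(1) show "f d \<noteq> Some x"
  proof (cases rule: wheel_edge_cases)
    case rim
    then show ?thesis using assms(4) d zero_notin_rim_edge by auto
  next
    case spoke
    then show ?thesis using assms(3) by (auto simp: spoke_colors_def)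
  qed
qed

text \<open>Count the forbidden colours: one per coloured spoke at an end of \<open>e\<close>, and
  one per coloured rim edge next to \<open>e\<close>, of which there are at most two and at most as
  many as are coloured on the whole rim. The set \<open>C\<close> allows the choice to be restricted
  to colours already on spokes.\<close>

lemma rim_colorable:
  assumes n: "n \<ge> 3" and e: "e \<in> edges (cycle_graph n)" "f e = None"
    and C: "C \<subseteq> X"
    and card: "card (e - open_spokes n f) + min 2 (card (colored_rim n f)) < card C"
  shows "\<exists>x \<in> C. colorable (wheel n) X f e x"
proof -
  define D where "D = {d \<in> colored_rim n f. d \<noteq> e \<and> d \<inter> e \<noteq> {}}"
  \<comment> \<open>The forbidden colours; \<open>the\<close> is only applied to coloured
    edges.\<close>
  define F where "F = (\<lambda>v. the (f {0, v})) ` (e - open_spokes n f) \<union> (\<lambda>d. the (f d)) ` D"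
  have fe: "finite e" using rim_edge_subset[OF e(1)] finite_subset by blast
  have fD: "finite D" using finite_colored_rim[of n f] by (simp add: D_def)
  have "card D \<le> card {d \<in> edges (cycle_graph n). d \<noteq> e \<and> d \<inter> e \<noteq> {}}"
    by (intro card_mono) (auto simp: D_def colored_rim_def finite_edges_cycle_graph)
  then have "card D \<le> 2" using adjacent_rim_edges[OF n e(1)] by simp
  moreover have "card D \<le> card (colored_rim n f)"
    by (intro card_mono finite_colored_rim) (auto simp: D_def)
  ultimately have D: "card D \<le> min 2 (card (colored_rim n f))" by simp
  have "card F \<le> card ((\<lambda>v. the (f {0, v})) ` (e - open_spokes n f)) + card ((\<lambda>d. the (f d)) ` D)"
    unfolding F_def by (rule card_Un_le)
  also have "\<dots> \<le> card (e - open_spokes n f) + card D"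
    using fe fD by (intro add_mono card_image_le) auto
  finally have "card F < card C" using D card by linarith
  moreover have "finite F" using fe fD by (simp add: F_def)
  ultimately have "\<not> C \<subseteq> F" using card_mono[of F C] by auto
  then obtain x where x: "x \<in> C" "x \<notin> F" by blast
  have "colorable (wheel n) X f e x"
    unfolding colorable_def
  proof (intro conjI ballI impI)
    show "e \<in> edges (wheel n)" "f e = None" "x \<in> X"
      using e x C by (auto simp: edges_wheel)
    fix d assume "d \<in> edges (wheel n)" and d: "d \<noteq> e \<and> d \<inter> e \<noteq> {}"
    from this(1) show "f d \<noteq> Some x"
    proof (cases rule: wheel_edge_cases)
      case rim
      show ?thesis
      proof
        assume "f d = Some x"
        then have "d \<in> D" "the (f d) = x" using rim d by (auto simp: D_def colored_rim_def)
        then show False using x(2) by (auto simp: F_def)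
      qed
    next
      case (spoke v)
      show ?thesis
      proof
        assume c: "f d = Some x"
        have "v \<in> e" using d spoke zero_notin_rim_edge[OF e(1)] by auto
        then have "v \<in> e - open_spokes n f" "the (f {0, v}) = x"
          using c spoke by (auto simp: open_spokes_def)
        then show False using x(2) by (auto simp: F_def)
      qed
    qed
  qed
  then show ?thesis using x by blast
qed

text \<open>A rim edge has at most four neighbours, two spokes and two rim edges, so five colours
  always leave one free.\<close>

lemma rim_colorable_5:
  assumes n: "n \<ge> 5" and e: "e \<in> edges (cycle_graph n)" "f e = None"
  shows "\<exists>x. colorable (wheel n) {..<n} f e x"
proof -
  have "finite e" using rim_edge_subset[OF e(1)] finite_subset by blast
  then have "card (e - open_spokes n f) \<le> card e" by (intro card_mono) auto
  then have "card (e - open_spokes n f) + min 2 (card (colored_rim n f)) < card {..<n}"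
    using card_rim_edge_le[OF e(1)] n by simp
  then show ?thesis
    using rim_colorable[where f = f and C = "{..<n}" and X = "{..<n}" and n = n and e = e] e n by auto
qed

text \<open>Once \<open>x\<close> is on a spoke it is lost to every other spoke anyway, so rim edges
  coloured \<open>x\<close> do no further harm. With \<open>x\<close> the colour of a threat, this
  is Maker's answer to it.\<close>

lemma rim_colors_in_spoke:
  assumes "rim_colors_in n f (insert x (spoke_colors n f))" "v \<in> open_spokes n f"
  shows "rim_colors_in n (f({0, v} \<mapsto> x)) (spoke_colors n (f({0, v} \<mapsto> x)))"
  unfolding rim_colors_in_def
  using assms unfolding spoke_update(1,2)[OF assms(2)]
  by (auto simp: spoke_update(4)[OF assms(2)] rim_colors_in_def simp del: fun_upd_apply)

lemma rim_colors_in_rim: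
  assumes "rim_colors_in n f S" "e \<in> edges (cycle_graph n)"
    and "x \<in> S \<or> e \<inter> open_spokes n f = {}"
  shows "rim_colors_in n (f(e \<mapsto> x)) S"
  unfolding rim_colors_in_def
  using assms by (auto simp: rim_update(1)[OF assms(2)] rim_colors_in_def)

lemma rim_colors_in_mono: "rim_colors_in n f S \<Longrightarrow> S \<subseteq> T \<Longrightarrow> rim_colors_in n f T"
  by (auto simp: rim_colors_in_def)

section \<open>Maker's invariant\<close>

text \<open>Whichever uncoloured rim edge Breaker takes, some open spoke is not incident to it. With
  at least three open spokes this is automatic.\<close>

definition unjoined :: "nat \<Rightarrow> (nat set \<Rightarrow> 'c option) \<Rightarrow> bool" where
  "unjoined n f \<longleftrightarrow> (\<forall>e \<in> edges (cycle_graph n). f e = None \<longrightarrow> \<not> open_spokes n f \<subseteq> e)"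

text \<open>Breaker colours at most one rim edge per round, Maker \<open>m \<ge> 2\<close> spokes.  The bound
  serves only to leave Maker room for his single move on the rim.\<close>

definition few_rim_colored :: "nat \<Rightarrow> nat \<Rightarrow> nat \<Rightarrow> (nat set \<Rightarrow> 'c option) \<Rightarrow> bool" where
  "few_rim_colored m n k f \<longleftrightarrow>
     2 * card (colored_rim n f) + (m - k) + card (open_spokes n f) \<le> n"

text \<open>Either Maker can finish the spokes within the turn, or the position must be prepared for
  later turns. At \<open>k = 0\<close> the bound on coloured rim edges is dropped for at most two
  open spokes: his single rim move may break it, but his next turn of \<open>m \<ge> 2\<close> moves
  suffices for those spokes.\<close>

definition safe :: "nat \<Rightarrow> nat \<Rightarrow> nat \<Rightarrow> (nat set \<Rightarrow> nat option) \<Rightarrow> bool" where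
  "safe m n k f \<longleftrightarrow> rim_colors_in n f (spoke_colors n f) \<and>
     (card (open_spokes n f) \<le> k \<or>
      (card (open_spokes n f) \<le> 2 \<or> few_rim_colored m n k f) \<and>
      (if k = 0 then unjoined n f else few_rim_colored m n k f))"

text \<open>Describes positions after Breaker puts a new colour \<open>a\<close> on the rim;
  \<open>v\<close> is an open spoke on which Maker can still use \<open>a\<close>.\<close>

definition threatened :: "nat \<Rightarrow> nat \<Rightarrow> nat \<Rightarrow> (nat set \<Rightarrow> nat option) \<Rightarrow> bool" where
  "threatened m n k f \<longleftrightarrow> k = m \<and> (card (open_spokes n f) \<le> 2 \<or> few_rim_colored m n m f) \<and>
     (\<exists>a < n. a \<notin> spoke_colors n f \<and> rim_colors_in n f (insert a (spoke_colors n f)) \<and>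
        (\<exists>v \<in> open_spokes n f. \<forall>e \<in> edges (cycle_graph n). v \<in> e \<longrightarrow> f e \<noteq> Some a))"

lemma safe_start:
  assumes "m \<ge> 2"
  shows "safe m n m Map.empty"
proof -
  have "card (open_spokes n (Map.empty :: nat set \<Rightarrow> nat option)) \<le> n" by (rule card_open_spokes_le)
  then show ?thesis
    using assms by (simp add: safe_def rim_colors_in_def few_rim_colored_def colored_rim_def)
qed

section \<open>Preservation of the invariant by the moves\<close>

lemma breaker_step:
  assumes m: "m \<ge> 2" and n: "n \<ge> 5" and f: "proper_coloring (wheel n) {..<n} f"
    and safe: "safe m n 0 f" and col: "colorable (wheel n) {..<n} f e x"
  shows "safe m n m (f(e \<mapsto> x)) \<or> threatened m n m (f(e \<mapsto> x))"
proof -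
  let ?g = "f(e \<mapsto> x)" and ?U = "open_spokes n f" and ?S = "spoke_colors n f"
  have clean: "rim_colors_in n f ?S" using safe by (simp add: safe_def)
  have dis: "card ?U = 0 \<or> (card ?U \<le> 2 \<or> few_rim_colored m n 0 f) \<and> unjoined n f"
    using safe by (auto simp: safe_def)
  have xe: "x < n" "f e = None" using col by (auto simp: colorable_def)
  consider "e \<in> edges (cycle_graph n)" | v where "v \<in> ?U" "e = {0, v}"
  proof -
    have "e \<in> edges (wheel n)" using col by (simp add: colorable_def)
    then show ?thesis
      by (cases rule: wheel_edge_cases) (use that xe in \<open>auto simp: open_spokes_def\<close>)
  qed
  then show ?thesis
  proof cases
    case 1
    note up = rim_update(1,2)[OF 1] card_colored_rim_update[where f = f, OF 1 xe(2)]
    \<comment> \<open>The new rim edge adds 2 to the left side, while the term \<open>m - k\<close>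
      falls from \<open>m\<close> to 0; hence \<open>m \<ge> 2\<close> pays for it.\<close>
    have few: "few_rim_colored m n m ?g" if "few_rim_colored m n 0 f"
      using that m by (simp add: few_rim_colored_def up)
    show ?thesis
    proof (cases "x \<in> ?S \<or> ?U = {}")
      case True
      then have "rim_colors_in n ?g ?S" using rim_colors_in_rim[OF clean 1] by blast
      then have "safe m n m ?g" using dis m few by (auto simp: safe_def up)
      then show ?thesis by blast
    next
      case False
      then have "card ?U \<noteq> 0" using finite_open_spokes[of n f] by auto
      then have good: "card ?U \<le> 2 \<or> few_rim_colored m n 0 f" "unjoined n f" using dis by auto
      \<comment> \<open>This is the purpose of \<open>unjoined\<close>: Breaker's edge misses some
        open spoke. The rim edges there carry only spoke colours, so not the new colour
        \<open>x\<close>.\<close>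
      then obtain v where v: "v \<in> ?U" "v \<notin> e" using 1 xe by (auto simp: unjoined_def)
      have "rim_colors_in n ?g (insert x ?S)"
        by (rule rim_colors_in_rim[OF rim_colors_in_mono[OF clean] 1]) auto
      moreover have "\<forall>d \<in> edges (cycle_graph n). v \<in> d \<longrightarrow> ?g d \<noteq> Some x"
        using v False clean by (auto simp: rim_colors_in_def)
      ultimately have "threatened m n m ?g"
        using v False xe good few by (auto simp: threatened_def up simp del: fun_upd_apply)
      then show ?thesis by blast
    qed
  next
    case 2
    have "rim_colors_in n ?g (spoke_colors n ?g)"
      unfolding 2(2) by (rule rim_colors_in_spoke[OF rim_colors_in_mono[OF clean] 2(1)]) auto
    moreover have "card (open_spokes n ?g) = card ?U - 1"
      using card_open_spokes_update[OF 2(1)] 2 by simp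
    moreover have "few_rim_colored m n m ?g" if "few_rim_colored m n 0 f"
      using that calculation(2) 2 by (simp add: few_rim_colored_def spoke_update)
    ultimately have "safe m n m ?g" using dis m by (auto simp: safe_def)
    then show ?thesis by blast
  qed
qed

text \<open>Maker puts \<open>a\<close> on \<open>v\<close>, which makes \<open>a\<close> a spoke
  colour and restores the condition on the rim.\<close>

lemma threatened_step:
  assumes m: "m \<ge> 2" and thr: "threatened m n k f"
  shows "\<exists>e x. colorable (wheel n) {..<n} f e x \<and> safe m n (k - 1) (f(e \<mapsto> x))"
proof -
  obtain a v where k: "k = m" and c: "card (open_spokes n f) \<le> 2 \<or> few_rim_colored m n m f"
    and a: "a < n" "a \<notin> spoke_colors n f" "rim_colors_in n f (insert a (spoke_colors n f))"
    and v: "v \<in> open_spokes n f" "\<And>e. e \<in> edges (cycle_graph n) \<Longrightarrow> v \<in> e \<Longrightarrow> f e \<noteq> Some a"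
    using thr by (auto simp: threatened_def)
  let ?g = "f({0, v} \<mapsto> a)"
  have "colorable (wheel n) {..<n} f {0, v} a"
    using a v by (intro spoke_colorable) auto
  moreover have "safe m n (k - 1) ?g"
  proof -
    have "card (open_spokes n f) > 0" using v finite_open_spokes card_gt_0_iff by blast
    then have "few_rim_colored m n (k - 1) ?g" if "few_rim_colored m n m f"
      using that k m
      by (simp add: few_rim_colored_def spoke_update(3)[OF v(1)] card_open_spokes_update[OF v(1)])
    \<comment> \<open>Since \<open>m \<ge> 2\<close>, at least one move of the turn remains, so
      \<open>unjoined\<close> is not yet demanded; if at most two spokes were open, the at most one
      left can still be coloured in this turn.\<close>
    then show ?thesis
      using rim_colors_in_spoke[OF a(3) v(1)] c k m card_open_spokes_update[OF v(1), of a]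
      by (auto simp: safe_def)
  qed
  ultimately show ?thesis by blast
qed

lemma safe_spoke_colorable:
  assumes "proper_coloring (wheel n) {..<n} f" "rim_colors_in n f (spoke_colors n f)"
    and "v \<in> open_spokes n f"
  shows "\<exists>x. colorable (wheel n) {..<n} f {0, v} x"
proof -
  obtain x where "x < n" "x \<notin> spoke_colors n f" using unused_color assms by blast
  then have "colorable (wheel n) {..<n} f {0, v} x"
    using assms(2,3) by (intro spoke_colorable) (auto simp: rim_colors_in_def)
  then show ?thesis by blast
qed

text \<open>On his last move with two open spokes, Maker must not leave one spoke exposed to
  Breaker. He colours a rim edge instead: the one joining the two open spokes if it is uncoloured,
  otherwise any uncoloured one.\<close>

lemma passing_move:
  assumes m: "m \<ge> 2" and n: "n \<ge> 5" and f: "proper_coloring (wheel n) {..<n} f"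
    and clean: "rim_colors_in n f (spoke_colors n f)"
    and few: "few_rim_colored m n 1 f" and U: "card (open_spokes n f) = 2"
  shows "\<exists>e x. colorable (wheel n) {..<n} f e x \<and> safe m n 0 (f(e \<mapsto> x))"
proof -
  let ?U = "open_spokes n f" and ?S = "spoke_colors n f"
  have rho: "2 * card (colored_rim n f) + 3 \<le> n" using few U m by (simp add: few_rim_colored_def)
  have S: "card ?S = n - 2" "?S \<subseteq> {..<n}"
    using card_spoke_colors[OF f] spoke_colors_subset[OF f] U by auto
  have "\<exists>e \<in> edges (cycle_graph n). f e = None"
  proof (rule ccontr)
    assume "\<not> ?thesis"
    then have "colored_rim n f = edges (cycle_graph n)" by (auto simp: colored_rim_def)
    then show False using rho card_edges_cycle_graph[of n] n by simp
  qed
  then obtain e where e: "e \<in> edges (cycle_graph n)" "f e = None" and sub: "unjoined n f \<or> ?U \<subseteq> e"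
    by (auto simp: unjoined_def)
  have fe: "finite e" using rim_edge_subset[OF e(1)] finite_subset by blast
  \<comment> \<open>Only one rim edge can contain both open spokes, so colouring it removes the only
    obstruction to \<open>unjoined\<close>.\<close>
  have e_eq: "e = d" if "?U \<subseteq> e" "d \<in> edges (cycle_graph n)" "?U \<subseteq> d" for d
  proof -
    have "?U = e" using that e fe card_rim_edge_le[OF e(1)] U by (metis card_seteq)
    moreover have "?U = d"
      using that card_rim_edge_le[OF that(2)] U rim_edge_subset[OF that(2)]
      by (metis card_seteq finite_subset finite_atLeastAtMost)
    ultimately show ?thesis by simp
  qed
  have "\<exists>x. colorable (wheel n) {..<n} f e x \<and> (x \<in> ?S \<or> e \<inter> ?U = {})"
  proof (cases "e \<inter> ?U = {}")
    case True
    then show ?thesis using rim_colorable_5[of n e f] n e by blast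
  next
    case False
    then have "card (e - ?U) < card e" using fe by (intro psubset_card_mono) auto
    then have "card (e - ?U) \<le> 1" using card_rim_edge_le[OF e(1)] by simp
    \<comment> \<open>The tight case is \<open>n = 5\<close>: there \<open>rho\<close> allows only
      one coloured rim edge, so at most two of the three spoke colours are forbidden.\<close>
    then have "card (e - ?U) + min 2 (card (colored_rim n f)) < card ?S"
      using S rho n by linarith
    then show ?thesis
      using rim_colorable[where f = f and C = ?S and X = "{..<n}" and n = n and e = e] e S(2) n by auto
  qed
  then obtain x where x: "colorable (wheel n) {..<n} f e x" "x \<in> ?S \<or> e \<inter> ?U = {}" by blast
  have "unjoined n (f(e \<mapsto> x))"
    using sub e_eq by (auto simp: unjoined_def rim_update(1)[OF e(1)])
  then have "safe m n 0 (f(e \<mapsto> x))"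
    using rim_colors_in_rim[OF clean e(1) x(2)] U
    by (simp add: safe_def rim_update[OF e(1)])
  then show ?thesis using x by blast
qed

lemma maker_step:
  assumes m: "m \<ge> 2" and n: "n \<ge> 5" and f: "proper_coloring (wheel n) {..<n} f"
    and safe: "safe m n (Suc k) f" and ex: "\<exists>e x. colorable (wheel n) {..<n} f e x"
  shows "\<exists>e x. colorable (wheel n) {..<n} f e x \<and> safe m n k (f(e \<mapsto> x))"
proof -
  let ?U = "open_spokes n f"
  have clean: "rim_colors_in n f (spoke_colors n f)" using safe by (simp add: safe_def)
  have dis: "card ?U \<le> Suc k \<or> few_rim_colored m n (Suc k) f" using safe by (auto simp: safe_def)
  \<comment> \<open>A spoke move is safe if it keeps all remaining spokes within reach this turn, if
    it is not the last move of the turn, or if no rim edge contains all the spokes left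
    open.\<close>
  have spoke: ?thesis
    if v: "v \<in> ?U" and ok: "card ?U \<le> Suc k \<or> k > 0 \<or>
        (\<forall>e \<in> edges (cycle_graph n). \<not> ?U - {v} \<subseteq> e)" for v
  proof -
    obtain x where x: "colorable (wheel n) {..<n} f {0, v} x"
      using safe_spoke_colorable[OF f clean v] by blast
    let ?g = "f({0, v} \<mapsto> x)"
    have "card ?U > 0" using v finite_open_spokes card_gt_0_iff by blast
    then have "few_rim_colored m n k ?g" if "few_rim_colored m n (Suc k) f"
      using that by (simp add: few_rim_colored_def spoke_update(3)[OF v] card_open_spokes_update[OF v])
    moreover have "unjoined n ?g" if "\<forall>e \<in> edges (cycle_graph n). \<not> ?U - {v} \<subseteq> e"
      using that by (simp add: unjoined_def spoke_update[OF v] del: fun_upd_apply)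
    moreover have "rim_colors_in n ?g (spoke_colors n ?g)"
      by (rule rim_colors_in_spoke[OF rim_colors_in_mono[OF clean] v]) auto
    ultimately have "safe m n k ?g"
      using ok dis card_open_spokes_update[OF v, of x] by (auto simp: safe_def)
    then show ?thesis using x by blast
  qed
  \<comment> \<open>Only the last move of a turn needs care: with two open spokes Maker passes on
    the rim, with three he leaves a nonadjacent pair, and with more at least three remain, too many
    for one rim edge.\<close>
  consider "?U = {}" | "?U \<noteq> {}" "card ?U \<le> Suc k \<or> k > 0" | "k = 0" "card ?U = 2"
    | "k = 0" "card ?U = 3" | "k = 0" "card ?U > 3"
    by linarith
  then show ?thesis
  proof cases
    case 1
    obtain e x where col: "colorable (wheel n) {..<n} f e x" using ex by blast
    have "open_spokes n (f(e \<mapsto> x)) = {}" using 1 by (auto simp: open_spokes_def)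
    then have "safe m n k (f(e \<mapsto> x))" by (simp add: safe_def rim_colors_in_def)
    then show ?thesis using col by blast
  next
    case 2
    then show ?thesis using spoke by blast
  next
    case 3
    then show ?thesis using passing_move[OF m n f clean] dis by simp
  next
    case 4
    have "?U \<subseteq> {1..n}" by (auto simp: open_spokes_def)
    then obtain v where "v \<in> ?U" "\<forall>e \<in> edges (cycle_graph n). \<not> ?U - {v} \<subseteq> e"
      using nonadjacent_pair[of n ?U] n 4 by auto
    then show ?thesis using spoke by blast
  next
    case 5
    then obtain v where v: "v \<in> ?U" by fastforce
    have "\<not> ?U - {v} \<subseteq> e" if "e \<in> edges (cycle_graph n)" for e
    proof
      assume "?U - {v} \<subseteq> e"
      moreover have "finite e" using rim_edge_subset[OF that] finite_subset by blast
      ultimately have "card (?U - {v}) \<le> card e" using card_mono by blast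
      then show False using 5 v card_rim_edge_le[OF that] by simp
    qed
    then show ?thesis using spoke v by blast
  qed
qed

lemma maker_wins_wheel:
  fixes m n :: nat
  assumes m: "m \<ge> 2" and n: "n \<ge> 5"
  shows "\<exists>\<sigma>. winning_strategy (wheel n) {..<n} m \<sigma>"
proof (rule winning_strategy_if_invariant[where P = "\<lambda>k f. proper_coloring (wheel n) {..<n} f \<and>
    (safe m n k f \<or> threatened m n k f)"], goal_cases)
  case 1
  then show ?case using safe_start[OF m] by (simp add: proper_coloring_def)
next
  case (2 f e x)
  \<comment> \<open>A threat exists only at the start of Maker's turn, so Breaker always moves from
    a safe position.\<close>
  have "\<not> threatened m n 0 f" using m by (simp add: threatened_def)
  then have f: "proper_coloring (wheel n) {..<n} f" "safe m n 0 f" using 2(1) by simp_all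
  show ?case using breaker_step[OF m n f 2(2)] proper_coloring_update[OF f(1) 2(2)] by (intro conjI)
next
  case (3 k f)
  then have f: "proper_coloring (wheel n) {..<n} f" by simp
  have "\<exists>e x. colorable (wheel n) {..<n} f e x \<and> safe m n k (f(e \<mapsto> x))"
  proof (cases "safe m n (Suc k) f")
    case True
    then show ?thesis using maker_step[OF m n f True 3(2)] by simp
  next
    case False
    then show ?thesis using threatened_step[OF m, of n "Suc k" f] 3(1) by simp
  qed
  then obtain e x where "colorable (wheel n) {..<n} f e x" "safe m n k (f(e \<mapsto> x))" by blast
  then show ?case using proper_coloring_update[OF f] by metis
next
  case (4 k f e)
  from 4(2) show ?case
  proof (cases rule: wheel_edge_cases)
    case rim
    then show ?thesis using rim_colorable_5[where f = f, OF n rim 4(3)] by blast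
  next
    case (spoke v)
    then have v: "v \<in> open_spokes n f" using 4(3) by (simp add: open_spokes_def)
    show ?thesis
    proof (cases "safe m n k f")
      case True
      then have "rim_colors_in n f (spoke_colors n f)" by (simp add: safe_def)
      then show ?thesis using safe_spoke_colorable[OF _ _ v] 4(1) by blast
    next
      case False
      then have "threatened m n k f" using 4(1) by simp
      then show ?thesis using threatened_step[OF m] by blast
    qed
  qed
qed

section \<open>The lower bound and the theorem\<close>

lemma proper_coloring_wheel_imp_le:
  assumes f: "proper_coloring (wheel n) {..<k} f" and "\<forall>e \<in> edges (wheel n). f e \<noteq> None"
  shows "n \<le> k"
proof -
  have "open_spokes n f = {}" using assms(2) by (auto simp: open_spokes_def edges_wheel)
  then have "card (spoke_colors n f) = n" using card_spoke_colors[OF f] by simp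
  then show ?thesis using card_mono[OF _ spoke_colors_subset[OF f]] by simp
qed

theorem theorem4p3:
  fixes m n :: nat
  assumes "m \<ge> 2" and "n \<ge> 5"
  shows "game_chromatic_index (wheel n) m = n"
  unfolding game_chromatic_index_def
proof (rule Least_equality)
  show "\<exists>\<sigma> :: (nat, nat) strategy. winning_strategy (wheel n) {..<n} m \<sigma>"
    using maker_wins_wheel assms by blast
next
  fix k assume "\<exists>\<sigma> :: (nat, nat) strategy. winning_strategy (wheel n) {..<k} m \<sigma>"
  moreover have "finite (edges (wheel n))"
    by (simp add: edges_wheel finite_edges_cycle_graph)
  ultimately show "n \<le> k"
    using winning_strategy_imp_proper_coloring proper_coloring_wheel_imp_le by metis
qed

end
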